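(* For generic $A\in M_n(\mathbb{H})$, the fibre $\mathcal{F}_A=\{(A,B):(A,B)\in\mathcal{W}_n\}$ is the union of $n!$ real vector spaces, each of dimension $2n(n+1)$ (where $\{A\}\times M_n(\mathbb{H})$ is identified with the real vector space $M_n(\mathbb{H})$). Any two of these spaces intersect in a common vector subspace of (real) dimension $\ge 4n$.
   Context: $\mathbb{H}$ is the division ring of real quaternions and $M_n(\mathbb{H})$ is the space of $n\times n$ quaternionic matrices, a real vector space of dimension $4n^2$. $\mathcal{W}_n$ is the set of all pairs $(A,B)\in M_n(\mathbb{H})\times M_n(\mathbb{H})$ that are simultaneously triangularizable, i.e. for which there is $P\in\mathrm{GL}_n(\mathbb{H})$ such that $PAP^{-1}$ and $PBP^{-1}$ are both upper triangular. $\mathcal{F}_A$ is the fibre over $A$ of the first projection $\mathcal{W}_n\to M_n(\mathbb{H})$. Eigenvalues: every $A\in M_n(\mathbb{H})$ is conjugate under $\mathrm{GL}_n(\mathbb{H})$ to an upper triangular matrix whose successive diagonal entries $\lambda_1,\dots,\lambda_n$ lie in $\mathbb{C}=\{a+\mathsf{i}b\}\subset\mathbb{H}$ and have imaginary parts $\ge0$; this sequence is unique up to permutation, and $\lambda_1,\dots,\lambda_n$ are called the eigenvalues of $A$. The matrix $A$ is generic if it has $n$ distinct eigenvalues. *)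

theory Defs
  imports "HOL-Analysis.Analysis"
begin

text \<open>
  \<^term>\<open>Quat a b c d\<close> is the quaternion \<open>a + b i + c j + d k\<close>.
\<close>

datatype quat = Quat (qRe: real) (qI: real) (qJ: real) (qK: real)

lemma quat_eq_iff: "x = y \<longleftrightarrow> qRe x = qRe y \<and> qI x = qI y \<and> qJ x = qJ y \<and> qK x = qK y"
  by (auto intro: quat.expand)

instantiation quat :: real_div_algebra
begin

definition "0 = Quat 0 0 0 0"

definition "1 = Quat 1 0 0 0"

definition "- x = Quat (- qRe x) (- qI x) (- qJ x) (- qK x)"

definition "x + y = Quat (qRe x + qRe y) (qI x + qI y) (qJ x + qJ y) (qK x + qK y)"

definition "x - y = Quat (qRe x - qRe y) (qI x - qI y) (qJ x - qJ y) (qK x - qK y)"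

definition "r *\<^sub>R x = Quat (r * qRe x) (r * qI x) (r * qJ x) (r * qK x)"

definition "x * y = Quat
  (qRe x * qRe y - qI x * qI y - qJ x * qJ y - qK x * qK y)
  (qRe x * qI y + qI x * qRe y + qJ x * qK y - qK x * qJ y)
  (qRe x * qJ y - qI x * qK y + qJ x * qRe y + qK x * qI y)
  (qRe x * qK y + qI x * qJ y - qJ x * qI y + qK x * qRe y)"

definition "inverse x =
  (1 / ((qRe x)\<^sup>2 + (qI x)\<^sup>2 + (qJ x)\<^sup>2 + (qK x)\<^sup>2)) *\<^sub>R Quat (qRe x) (- qI x) (- qJ x) (- qK x)"

definition "x div y = x * inverse y" for x y :: quat

instance
proof
  fix x :: quat
  let ?s = "(qRe x)\<^sup>2 + (qI x)\<^sup>2 + (qJ x)\<^sup>2 + (qK x)\<^sup>2"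
  assume "x \<noteq> 0"
  then have "?s \<noteq> 0"
    by (auto simp: zero_quat_def quat_eq_iff add_nonneg_eq_0_iff)
  moreover have "inverse x * x = (1 / ?s) *\<^sub>R Quat ?s 0 0 0" "x * inverse x = (1 / ?s) *\<^sub>R Quat ?s 0 0 0"
    by (auto simp: times_quat_def inverse_quat_def scaleR_quat_def algebra_simps power2_eq_square
        simp flip: add_divide_distrib diff_divide_distrib)
  ultimately show "inverse x * x = 1" "x * inverse x = 1"
    by (simp_all add: scaleR_quat_def one_quat_def)
qed (simp_all add: zero_quat_def one_quat_def uminus_quat_def plus_quat_def minus_quat_def
    scaleR_quat_def times_quat_def inverse_quat_def divide_quat_def quat_eq_iff algebra_simps)

end

definition quat_of_complex :: "complex \<Rightarrow> quat" where
  "quat_of_complex z = Quat (Re z) (Im z) 0 0"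

text \<open>
  Quaternionic \<open>n \<times> n\<close> matrices are indexed by a finite linearly ordered type with \<open>n\<close>
  elements; the order gives triangularity its meaning.
\<close>

type_synonym 'n qmat = "quat ^ 'n ^ 'n"

definition upper_triangular :: "'n::{finite,linorder} qmat \<Rightarrow> bool" where
  "upper_triangular M \<longleftrightarrow> (\<forall>i j. j < i \<longrightarrow> M $ i $ j = 0)"

text \<open>
  The sequence \<open>ev\<close> lists the eigenvalues of \<open>A\<close>, with multiplicity. Every quaternionic matrix has
  such a sequence, and it is unique up to permutation.
\<close>

definition eigenvalue_seq :: "'n::{finite,linorder} qmat \<Rightarrow> ('n \<Rightarrow> complex) \<Rightarrow> bool" where
  "eigenvalue_seq A ev \<longleftrightarrow> (\<exists>P :: 'n qmat. invertible P \<and>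
     upper_triangular (P ** A ** matrix_inv P) \<and>
     (\<forall>i. (P ** A ** matrix_inv P) $ i $ i = quat_of_complex (ev i) \<and> 0 \<le> Im (ev i)))"

definition generic :: "'n::{finite,linorder} qmat \<Rightarrow> bool" where
  "generic A \<longleftrightarrow> (\<exists>ev. eigenvalue_seq A ev \<and> inj ev)"

definition triangularizable_pairs ::
  "('n::{finite,linorder} qmat \<times> 'n qmat) set" where
  "triangularizable_pairs = {(A, B). \<exists>P :: 'n qmat. invertible P \<and>
     upper_triangular (P ** A ** matrix_inv P) \<and> upper_triangular (P ** B ** matrix_inv P)}"

definition fibre ::
  "'n::{finite,linorder} qmat \<Rightarrow> ('n qmat \<times> 'n qmat) set" where
  "fibre A = {p \<in> triangularizable_pairs. fst p = A}"

end

theory Submission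
  imports Defs
begin

text \<open>
  Entries of the upper half plane are similar in the quaternions only if they are equal, so the
  Sylvester equations met in back substitution are solvable and a generic \<open>A\<close> is conjugate to a
  diagonal matrix \<open>D\<close>. The right subspaces stable under \<open>D\<close> are the coordinate subspaces, hence
  the \<open>D\<close>-stable complete flags correspond to the permutations of the basis. Each permutation
  contributes the space of all \<open>B\<close> preserving its flag, which is the conjugate of the space of
  matrices supported on a permuted upper triangular pattern; all of these patterns contain the
  diagonal.
\<close>

section \<open>Diagonalization of triangular matrices\<close>

lemma matrix_inv_unique:
  fixes A B :: "'a::semiring_1 ^ 'n ^ 'n"
  assumes "A ** B = mat 1" "B ** A = mat 1"
  shows "matrix_inv A = B"
proof -
  have "A ** matrix_inv A = mat 1"
    unfolding matrix_inv_def by (rule someI2[of _ B]) (use assms in auto)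
  then have "B ** (A ** matrix_inv A) = B"
    by simp
  then show ?thesis
    by (simp add: matrix_mul_assoc assms)
qed

lemma invertible_matrix_inv:
  fixes A :: "'a::semiring_1 ^ 'n ^ 'n"
  assumes "invertible A"
  shows "A ** matrix_inv A = mat 1" "matrix_inv A ** A = mat 1"
  using assms matrix_inv_unique unfolding invertible_def by metis+

definition unitriangular :: "'n::{finite,linorder} qmat \<Rightarrow> bool" where
  "unitriangular Q \<longleftrightarrow> upper_triangular Q \<and> (\<forall>i. Q $ i $ i = 1)"

lemma sum_upper_triangular:
  assumes "upper_triangular T"
  shows "(\<Sum>k\<in>UNIV. T $ i $ k * y k) = T $ i $ i * y i + (\<Sum>k\<in>{i<..}. T $ i $ k * y k)"
proof -
  have "(\<Sum>k\<in>UNIV. T $ i $ k * y k) = (\<Sum>k\<in>insert i {i<..}. T $ i $ k * y k)"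
    using assms by (intro sum.mono_neutral_right) (auto simp: upper_triangular_def)
  then show ?thesis
    by simp
qed

text \<open>Each column is filled from its last row upwards, because the equation at
  \<open>(i, j)\<close> involves only entries of column \<open>j\<close> in rows below
  \<open>i\<close>. Keeping \<open>f\<close> abstract serves two uses: \<open>f i j r = r\<close>
  inverts a unitriangular matrix, and \<open>f i j r = T $ i $ i * r - r * T $ j $ j\<close>
  diagonalizes a triangular one.\<close>

lemma back_substitution:
  fixes T :: "'n::{finite,linorder} qmat" and f :: "'n \<Rightarrow> 'n \<Rightarrow> quat \<Rightarrow> quat"
  assumes "\<And>i j c. i < j \<Longrightarrow> \<exists>r. f i j r = c"
  obtains Q where "unitriangular Q"
    and "\<And>i j. i < j \<Longrightarrow> f i j (Q $ i $ j) + (\<Sum>k\<in>{i<..}. T $ i $ k * Q $ k $ j) = 0"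
proof -
  \<comment> \<open>\<open>P j y i r\<close> says that \<open>r\<close> is admissible as entry
    \<open>i\<close> of column \<open>j\<close>. It consults \<open>y\<close> only in rows below
    \<open>i\<close>, as recursion requires.\<close>
  define P where "P j y i r \<longleftrightarrow> (j < i \<longrightarrow> r = 0) \<and> (i = j \<longrightarrow> r = 1) \<and>
     (i < j \<longrightarrow> f i j r + (\<Sum>k\<in>{i<..}. T $ i $ k * y k) = 0)" for i j r and y :: "'n \<Rightarrow> quat"
  have "\<exists>y. \<forall>i. P j y i (y i)" for j
  proof (rule dependent_wf_choice)
    \<comment> \<open>Larger indices precede smaller ones, so the recursion starts at the last
      row.\<close>
    show "wf {(k, i :: 'n). i < k}"
      by (rule wf_subset[OF wf_measure[of "\<lambda>i. card {i<..}"]]) (auto intro!: psubset_card_mono)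
    show "P j f x r = P j g x r" if "\<And>z. (z, x) \<in> {(k, i). i < k} \<Longrightarrow> f z = g z" for f g x r
      using that by (simp add: P_def)
    show "\<exists>r. P j y i r" for i y
    proof (cases "i < j")
      case True
      then obtain r where "f i j r = - (\<Sum>k\<in>{i<..}. T $ i $ k * y k)"
        using assms by blast
      with True show ?thesis
        by (intro exI[of _ r]) (auto simp: P_def)
    qed (auto simp: P_def not_less_iff_gr_or_eq)
  qed
  then obtain y where y: "P j (y j) i (y j i)" for i j
    by metis
  show thesis
    by (rule that[of "\<chi> i j. y j i"])
      (use y in \<open>auto simp: P_def unitriangular_def upper_triangular_def\<close>)
qed

lemma unitriangular_right_inverse:
  assumes "unitriangular Q"
  obtains R where "unitriangular R" "Q ** R = mat 1"
proof -
  obtain R where R: "unitriangular R"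
    "\<And>i j. i < j \<Longrightarrow> R $ i $ j + (\<Sum>k\<in>{i<..}. Q $ i $ k * R $ k $ j) = 0"
    by (rule back_substitution[where f = "\<lambda>i j r. r" and T = Q]) auto
  have "(Q ** R) $ i $ j = mat 1 $ i $ j" for i j
  proof (cases i j rule: linorder_cases)
    case less
    then show ?thesis
      using R assms
      by (simp add: matrix_matrix_mult_def sum_upper_triangular unitriangular_def mat_def)
  next
    case equal
    moreover have "(\<Sum>k\<in>{i<..}. Q $ i $ k * R $ k $ j) = 0"
      using R equal by (intro sum.neutral) (auto simp: unitriangular_def upper_triangular_def)
    ultimately show ?thesis
      using R assms
      by (simp add: matrix_matrix_mult_def sum_upper_triangular unitriangular_def mat_def)
  next
    case greater
    moreover have "(\<Sum>k\<in>{i<..}. Q $ i $ k * R $ k $ j) = 0"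
      using R greater by (intro sum.neutral) (auto simp: unitriangular_def upper_triangular_def)
    ultimately show ?thesis
      using R assms
      by (simp add: matrix_matrix_mult_def sum_upper_triangular unitriangular_def mat_def
          upper_triangular_def)
  qed
  then show thesis
    using R that by (simp add: vec_eq_iff)
qed

lemma unitriangular_inverse:
  assumes "unitriangular Q"
  obtains R where "Q ** R = mat 1" "R ** Q = mat 1"
proof -
  obtain R where R: "unitriangular R" "Q ** R = mat 1"
    using unitriangular_right_inverse assms by blast
  obtain Q' where Q': "R ** Q' = mat 1"
    using unitriangular_right_inverse R(1) by blast
  have "Q = Q ** (R ** Q')"
    by (simp add: Q')
  also have "\<dots> = Q'"
    by (simp add: matrix_mul_assoc R)
  finally show thesis
    using that R Q' by simp
qed

definition diagonal :: "('n \<Rightarrow> quat) \<Rightarrow> 'n::finite qmat" where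
  "diagonal d = (\<chi> i j. if i = j then d i else 0)"

lemma diagonal_mult:
  "(diagonal d ** M) $ i $ j = d i * M $ i $ j" "(M ** diagonal d) $ i $ j = M $ i $ j * d j"
  by (simp_all add: diagonal_def matrix_matrix_mult_def if_distrib if_distribR cong: if_cong)

text \<open>Above the diagonal, entry \<open>(i, j)\<close> of \<open>T ** Q = Q ** D\<close> is a
  Sylvester equation for \<open>Q $ i $ j\<close> whose inhomogeneous term involves only lower rows
  of \<open>Q\<close>, so back substitution applies.\<close>

lemma triangular_diagonalizable:
  fixes T :: "'n::{finite,linorder} qmat"
  assumes T: "upper_triangular T"
    and sylvester: "\<And>i j c. i \<noteq> j \<Longrightarrow> \<exists>r. T $ i $ i * r - r * T $ j $ j = c"
  obtains Q where "unitriangular Q" "T ** Q = Q ** diagonal (\<lambda>i. T $ i $ i)"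
proof -
  obtain Q where Q: "unitriangular Q"
    "\<And>i j. i < j \<Longrightarrow> T $ i $ i * Q $ i $ j - Q $ i $ j * T $ j $ j
      + (\<Sum>k\<in>{i<..}. T $ i $ k * Q $ k $ j) = 0"
    by (rule back_substitution[where f = "\<lambda>i j r. T $ i $ i * r - r * T $ j $ j" and T = T])
      (use sylvester in auto)
  have "(T ** Q) $ i $ j = Q $ i $ j * T $ j $ j" for i j
  proof (cases "i < j")
    case True
    then show ?thesis
      using Q(2)[OF True] T
      by (simp add: matrix_matrix_mult_def sum_upper_triangular algebra_simps)
  next
    case False
    then have "(\<Sum>k\<in>{i<..}. T $ i $ k * Q $ k $ j) = 0"
      using Q by (intro sum.neutral) (auto simp: unitriangular_def upper_triangular_def)
    moreover have "i = j \<or> j < i"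
      using False by auto
    ultimately show ?thesis
      using Q T
      by (auto simp: matrix_matrix_mult_def sum_upper_triangular unitriangular_def
          upper_triangular_def)
  qed
  then show thesis
    using that[OF Q(1)] by (simp add: vec_eq_iff diagonal_mult)
qed

section \<open>Similar complex quaternions\<close>

lemma quat_of_complex_mult: "quat_of_complex (z * w) = quat_of_complex z * quat_of_complex w"
  by (simp add: quat_of_complex_def times_quat_def)

lemma quat_of_complex_eq_0_iff: "quat_of_complex z = 0 \<longleftrightarrow> z = 0"
  by (simp add: quat_of_complex_def zero_quat_def complex_eq_iff)

text \<open>
  The map \<open>r \<mapsto> a r - r b\<close> turns into left multiplication by \<open>f(a)\<close>, where
  \<open>f(x) = (x - b)(x - cnj b)\<close> is the real polynomial annihilating \<open>b\<close>, when it is composed in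
  either order with \<open>c \<mapsto> a c - c (cnj b)\<close>; hence it is bijective as soon as \<open>f(a) \<noteq> 0\<close>.
\<close>

lemma sylvester_identity:
  "quat_of_complex a * (quat_of_complex a * c - c * quat_of_complex (cnj b))
     - (quat_of_complex a * c - c * quat_of_complex (cnj b)) * quat_of_complex b
   = quat_of_complex ((a - b) * (a - cnj b)) * c"
  "quat_of_complex a * (quat_of_complex a * c - c * quat_of_complex b)
     - (quat_of_complex a * c - c * quat_of_complex b) * quat_of_complex (cnj b)
   = quat_of_complex ((a - b) * (a - cnj b)) * c"
  by (simp_all add: quat_eq_iff quat_of_complex_def times_quat_def minus_quat_def algebra_simps)

text \<open>Two points of the closed upper half plane can be conjugate to each other only if both
  are real, and then they coincide.\<close>

lemma upper_half_plane_char_poly_nonzero: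
  assumes "a \<noteq> b" "0 \<le> Im a" "0 \<le> Im b"
  shows "(a - b) * (a - cnj b) \<noteq> 0"
proof -
  have "a \<noteq> cnj b"
  proof
    assume "a = cnj b"
    with assms have "Im a = - Im b" "Re a = Re b" "Im a = 0"
      by auto
    then show False
      using \<open>a \<noteq> b\<close> by (simp add: complex_eq_iff)
  qed
  then show ?thesis
    using \<open>a \<noteq> b\<close> by simp
qed

lemma sylvester_solvable:
  assumes "a \<noteq> b" "0 \<le> Im a" "0 \<le> Im b"
  shows "\<exists>r. quat_of_complex a * r - r * quat_of_complex b = c"
proof -
  define f where "f = (a - b) * (a - cnj b)"
  define g where "g = quat_of_complex f"
  have "f \<noteq> 0"
    unfolding f_def using assms by (rule upper_half_plane_char_poly_nonzero)
  then have "g \<noteq> 0"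
    by (simp add: g_def quat_of_complex_eq_0_iff)
  \<comment> \<open>Both \<open>g\<close> and \<open>a\<close> are complex, so
    \<open>inverse g\<close> moves past left multiplication by \<open>a\<close>; \<open>b\<close>
    acts from the other side and causes no obstruction.\<close>
  have comm: "quat_of_complex a * inverse g = inverse g * quat_of_complex a"
    by (rule mult_commute_imp_mult_inverse_commute[symmetric])
      (simp add: g_def mult.commute flip: quat_of_complex_mult)
  define r where "r = quat_of_complex a * c - c * quat_of_complex (cnj b)"
  have "quat_of_complex a * (inverse g * r) - inverse g * r * quat_of_complex b
      = inverse g * (quat_of_complex a * r - r * quat_of_complex b)"
    by (simp add: mult.assoc[symmetric] comm right_diff_distrib)
  also have "\<dots> = inverse g * (g * c)"
    by (simp add: r_def sylvester_identity g_def f_def)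
  also have "\<dots> = c"
    using \<open>g \<noteq> 0\<close> by (simp add: mult.assoc[symmetric])
  finally show ?thesis
    by blast
qed

text \<open>This is the injectivity half of the Sylvester argument: an element of the kernel is
  annihilated by the nonzero factor of the second identity.\<close>

lemma complex_quat_not_similar:
  assumes "a \<noteq> b" "0 \<le> Im a" "0 \<le> Im b" "quat_of_complex a * y = y * quat_of_complex b"
  shows "y = 0"
proof -
  have "quat_of_complex ((a - b) * (a - cnj b)) * y = 0"
    using sylvester_identity(2)[of a y b] assms(4) by simp
  then show ?thesis
    using upper_half_plane_char_poly_nonzero[OF assms(1-3)]
    by (simp add: quat_of_complex_eq_0_iff del: mult_eq_0_iff)
       (simp add: quat_of_complex_eq_0_iff)
qed

section \<open>Invariant flags of a diagonal matrix\<close>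

text \<open>Over a division ring, a nonzero \<open>y\<close> with \<open>d i * y = y * d k\<close>
  conjugates \<open>d k\<close> into \<open>d i\<close>; phrasing this by intertwiners avoids
  inverses.\<close>

definition pairwise_nonsimilar :: "('n \<Rightarrow> 'a::ring) \<Rightarrow> bool" where
  "pairwise_nonsimilar d \<longleftrightarrow> (\<forall>i k y. i \<noteq> k \<longrightarrow> d i * y = y * d k \<longrightarrow> y = 0)"

text \<open>
  Subtracting \<open>D x\<close> from a right multiple of \<open>x\<close> kills any chosen coordinate of the support of
  \<open>x\<close> and, by non-similarity, no other one.
\<close>

lemma diagonal_invariant_axis:
  fixes d :: "'n::finite \<Rightarrow> 'a::division_ring"
  assumes nonsim: "pairwise_nonsimilar d"
    and diff: "\<And>x y. x \<in> W \<Longrightarrow> y \<in> W \<Longrightarrow> x - y \<in> W"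
    and scale: "\<And>x q. x \<in> W \<Longrightarrow> (\<chi> i. x $ i * q) \<in> W"
    and invariant: "\<And>x. x \<in> W \<Longrightarrow> (\<chi> i. d i * x $ i) \<in> W"
    and "x \<in> W" "x $ k \<noteq> 0"
  shows "axis k 1 \<in> W"
  using \<open>x \<in> W\<close> \<open>x $ k \<noteq> 0\<close>
proof (induction "card {i. x $ i \<noteq> 0}" arbitrary: x rule: less_induct)
  case less
  show ?case
  proof (cases "\<exists>i. i \<noteq> k \<and> x $ i \<noteq> 0")
    case True
    then obtain i where i: "i \<noteq> k" "x $ i \<noteq> 0"
      by blast
    \<comment> \<open>The right factor is the conjugate of \<open>d i\<close> by
      \<open>x $ i\<close>, chosen so that \<open>x $ i\<close> times it equals
      \<open>d i * x $ i\<close>.\<close>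
    define y where "y = (\<chi> l. x $ l * (inverse (x $ i) * d i * x $ i)) - (\<chi> l. d l * x $ l)"
    have "y \<in> W"
      unfolding y_def using less.prems by (intro diff scale invariant)
    moreover have "y $ i = 0"
      using i by (simp add: y_def mult.assoc[symmetric])
    moreover have "y $ l = 0" if "x $ l = 0" for l
      using that by (simp add: y_def)
    \<comment> \<open>Otherwise \<open>x $ k * inverse (x $ i)\<close> would be a nonzero
      intertwiner of \<open>d k\<close> and \<open>d i\<close>.\<close>
    moreover have "y $ k \<noteq> 0"
    proof
      assume "y $ k = 0"
      then have "x $ k * (inverse (x $ i) * d i * x $ i) * inverse (x $ i)
          = d k * x $ k * inverse (x $ i)"
        by (simp add: y_def)
      then have "d k * (x $ k * inverse (x $ i)) = x $ k * inverse (x $ i) * d i"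
        using i by (simp add: mult.assoc)
      then have "x $ k * inverse (x $ i) = 0"
        using nonsim i unfolding pairwise_nonsimilar_def by metis
      then show False
        using i less.prems by simp
    qed
    moreover have "card {l. y $ l \<noteq> 0} < card {l. x $ l \<noteq> 0}"
      using calculation(2,3) i by (intro psubset_card_mono) auto
    ultimately show ?thesis
      using less.hyps by blast
  next
    case False
    then have "(\<chi> l. x $ l * inverse (x $ k)) = axis k 1"
      using less.prems by (auto simp: vec_eq_iff axis_def)
    then show ?thesis
      using scale[OF less.prems(1)] by metis
  qed
qed

text \<open>Scalars act on the right so that matrices, acting on the left, are linear over the
  quaternions.\<close>

definition right_scale :: "'a::times ^ 'n \<Rightarrow> 'a \<Rightarrow> 'a ^ 'n" where
  "right_scale x q = (\<chi> i. x $ i * q)"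

lemma matrix_vector_right_scale:
  fixes X :: "'a::semiring_1 ^ 'n ^ 'm"
  shows "X *v right_scale v q = right_scale (X *v v) q"
  by (simp add: vec_eq_iff right_scale_def matrix_vector_mult_def sum_distrib_right mult.assoc)

lemma vec_sum_axis:
  fixes x :: "'a::semiring_1 ^ 'n"
  shows "x = (\<Sum>k\<in>UNIV. right_scale (axis k 1) (x $ k))"
  by (simp add: vec_eq_iff right_scale_def axis_def if_distrib if_distribR cong: if_cong)

lemma matrix_vector_axis:
  fixes X :: "'a::semiring_1 ^ 'n ^ 'm"
  shows "(X *v axis k 1) $ i = X $ i $ k"
  by (simp add: matrix_vector_mult_def axis_def if_distrib if_distribR cong: if_cong)

text \<open>Since \<open>K\<close> is an initial segment, \<open>l\<close> in \<open>K\<close> and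
  \<open>k\<close> outside \<open>K\<close> force \<open>l < k\<close>, hence
  \<open>M $ k $ l = 0\<close>; for \<open>l\<close> outside \<open>K\<close> the factor
  \<open>v $ l\<close> vanishes.\<close>

lemma upper_triangular_vanishing:
  fixes M :: "'n::{finite,linorder} qmat"
  assumes "upper_triangular M" "\<forall>i j. i \<le> j \<longrightarrow> j \<in> K \<longrightarrow> i \<in> K" "\<forall>k. k \<notin> K \<longrightarrow> v $ k = 0" "k \<notin> K"
  shows "(M *v v) $ k = 0"
proof -
  have "M $ k $ l * v $ l = 0" for l
    using assms by (cases "l \<in> K") (auto simp: upper_triangular_def simp flip: not_le)
  then show ?thesis
    by (simp only: matrix_vector_mult_def vec_lambda_beta sum.neutral_const)
qed

text \<open>The columns of \<open>X\<close> span a flag stable under \<open>diagonal d\<close>. A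
  stable member contains the axis of every coordinate that occurs in it, so each step of the flag
  brings in a new axis, recorded by \<open>\<sigma>\<close>. Since \<open>\<sigma>\<close> comes
  from the flag alone, it works for every \<open>B\<close> preserving the flag.\<close>

lemma diagonal_flag_permutation:
  fixes X Y T :: "'n::{finite,linorder} qmat"
  assumes nonsim: "pairwise_nonsimilar d"
    and YX: "Y ** X = mat 1"
    and T: "upper_triangular T" "diagonal d ** X = X ** T"
  obtains \<sigma> :: "'n \<Rightarrow> 'n" where "bij \<sigma>"
    and "\<And>B M i j. upper_triangular M \<Longrightarrow> B ** X = X ** M \<Longrightarrow> j < i \<Longrightarrow> B $ \<sigma> i $ \<sigma> j = 0"
proof -
  \<comment> \<open>\<open>W K\<close> is the right span of the columns of \<open>X\<close> with
    index in \<open>K\<close>; the flag consists of the \<open>W {..j}\<close>.\<close>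
  define W where "W K = {X *v v |v. \<forall>k. k \<notin> K \<longrightarrow> v $ k = 0}" for K
  have mono: "x \<in> W L" if "x \<in> W K" "K \<subseteq> L" for x K L
    using that by (auto simp: W_def)
  have diff: "x - y \<in> W K" if xy: "x \<in> W K" "y \<in> W K" for x y K
  proof -
    obtain v w where "x = X *v v" "y = X *v w" "\<forall>k. k \<notin> K \<longrightarrow> v $ k = 0" "\<forall>k. k \<notin> K \<longrightarrow> w $ k = 0"
      using xy by (auto simp: W_def)
    then show ?thesis
      unfolding W_def
      by (intro CollectI exI[of _ "v - w"])
        (simp add: vec_eq_iff matrix_vector_mult_def right_diff_distrib sum_subtractf)
  qed
  have zero: "0 \<in> W K" for K
    unfolding W_def by (intro CollectI exI[of _ 0]) (simp add: vec_eq_iff matrix_vector_mult_def)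
  have add: "x + y \<in> W K" if "x \<in> W K" "y \<in> W K" for x y K
    using diff[OF that(1) diff[OF zero that(2)]] by simp
  have scale: "right_scale x q \<in> W K" if x: "x \<in> W K" for x q K
  proof -
    obtain v where "x = X *v v" "\<forall>k. k \<notin> K \<longrightarrow> v $ k = 0"
      using x by (auto simp: W_def)
    then show ?thesis
      unfolding W_def
      by (intro CollectI exI[of _ "right_scale v q"])
        (auto simp: matrix_vector_right_scale, simp add: right_scale_def)
  qed
  have stable: "B *v x \<in> W K"
    if BM: "upper_triangular M" "B ** X = X ** M" and K: "\<forall>i j. i \<le> j \<longrightarrow> j \<in> K \<longrightarrow> i \<in> K"
      and x: "x \<in> W K" for B M x K
  proof -
    obtain v where v: "x = X *v v" "\<forall>k. k \<notin> K \<longrightarrow> v $ k = 0"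
      using x by (auto simp: W_def)
    have "B *v x = X *v (M *v v)"
      by (simp add: v matrix_vector_mul_assoc BM)
    moreover have "(M *v v) $ k = 0" if "k \<notin> K" for k
      using BM(1) K v(2) that by (rule upper_triangular_vanishing)
    ultimately show ?thesis
      unfolding W_def by blast
  qed
  have axis: "axis k 1 \<in> W K"
    if K: "\<forall>i j. i \<le> j \<longrightarrow> j \<in> K \<longrightarrow> i \<in> K" and x: "x \<in> W K" "x $ k \<noteq> 0" for k x K
  proof (rule diagonal_invariant_axis[where d = d and x = x])
    fix x assume "x \<in> W K"
    then have "diagonal d *v x \<in> W K"
      using stable[OF T K] by blast
    moreover have "diagonal d *v x = (\<chi> i. d i * x $ i)"
      by (simp add: vec_eq_iff matrix_vector_mult_def diagonal_def if_distrib if_distribR cong: if_cong)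
    ultimately show "(\<chi> i. d i * x $ i) \<in> W K"
      by simp
  qed (use nonsim diff scale x in \<open>auto simp: right_scale_def\<close>)
  \<comment> \<open>Without a new axis, every axis in the support of column \<open>j\<close> of
    \<open>X\<close> would lie in \<open>W {..<j}\<close>, and so would the column itself; the left
    inverse \<open>Y\<close> excludes this.\<close>
  have "\<exists>s. axis s 1 \<in> W {..j} \<and> axis s 1 \<notin> W {..<j}" for j
  proof (rule ccontr)
    assume contra: "\<not> ?thesis"
    define x where "x = X *v axis j 1"
    have "x \<in> W {..j}"
      unfolding W_def x_def by (auto simp: axis_def)
    have "right_scale (axis s 1) (x $ s) \<in> W {..<j}" for s
    proof (cases "x $ s = 0")
      case True
      then have "right_scale (axis s 1) (x $ s) = 0"
        by (simp add: vec_eq_iff right_scale_def)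
      then show ?thesis
        by (simp add: zero)
    next
      case False
      then have "axis s 1 \<in> W {..j}"
        by (intro axis[OF _ \<open>x \<in> W {..j}\<close>]) auto
      then show ?thesis
        using contra scale by blast
    qed
    then have "(\<Sum>s\<in>S. right_scale (axis s 1) (x $ s)) \<in> W {..<j}" for S :: "'n set"
      by (induction S rule: infinite_finite_induct) (simp_all add: zero add)
    then have "x \<in> W {..<j}"
      using vec_sum_axis[of x] by metis
    then obtain v where v: "X *v axis j 1 = X *v v" "v $ j = 0"
      by (auto simp: W_def x_def)
    have "Y *v (X *v axis j 1) = Y *v (X *v v)"
      by (simp add: v)
    then have "axis j 1 = v"
      by (simp add: matrix_vector_mul_assoc YX)
    then show False
      using v by (auto simp: axis_def)
  qed
  then obtain \<sigma> where \<sigma>: "axis (\<sigma> j) 1 \<in> W {..j}" "axis (\<sigma> j) 1 \<notin> W {..<j}" for j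
    by metis
  have "\<sigma> i \<noteq> \<sigma> j" if "i < j" for i j
  proof
    assume "\<sigma> i = \<sigma> j"
    moreover have "axis (\<sigma> i) 1 \<in> W {..<j}"
      using that by (intro mono[OF \<sigma>(1)[of i]]) auto
    ultimately show False
      using \<sigma>(2) by simp
  qed
  then have "inj \<sigma>"
    by (metis injI linorder_neqE)
  then have "bij \<sigma>"
    by (simp add: bij_def finite_UNIV_inj_surj)
  \<comment> \<open>The entry is coordinate \<open>\<sigma> i\<close> of the image of axis
    \<open>\<sigma> j\<close>, which stays in \<open>W {..j}\<close>. If it were nonzero, axis
    \<open>\<sigma> i\<close> would lie in \<open>W {..j}\<close>, which is contained in
    \<open>W {..<i}\<close>.\<close>
  moreover have "B $ \<sigma> i $ \<sigma> j = 0"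
    if "upper_triangular M" "B ** X = X ** M" "j < i" for B M i j
  proof (rule ccontr)
    assume "B $ \<sigma> i $ \<sigma> j \<noteq> 0"
    moreover have "B *v axis (\<sigma> j) 1 \<in> W {..j}"
      by (rule stable[OF that(1,2) _ \<sigma>(1)]) auto
    ultimately have "axis (\<sigma> i) 1 \<in> W {..j}"
      by (intro axis[where x = "B *v axis (\<sigma> j) 1"]) (auto simp: matrix_vector_axis)
    then have "axis (\<sigma> i) 1 \<in> W {..<i}"
      using mono that(3) by (metis atMost_subset_iff lessThan_iff atMost_iff le_less_trans subsetI)
    then show False
      using \<sigma>(2) by simp
  qed
  ultimately show thesis
    using that by blast
qed

section \<open>Matrices with prescribed support\<close>

definition supported :: "('n \<times> 'n) set \<Rightarrow> 'n::finite qmat set" where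
  "supported I = {M. \<forall>i j. (i, j) \<notin> I \<longrightarrow> M $ i $ j = 0}"

definition single :: "'n \<times> 'n \<Rightarrow> quat \<Rightarrow> 'n::finite qmat" where
  "single p u = (\<chi> i j. if p = (i, j) then u else 0)"

definition quat_units :: "quat set" where
  "quat_units = {Quat 1 0 0 0, Quat 0 1 0 0, Quat 0 0 1 0, Quat 0 0 0 1}"

lemma subspace_supported: "subspace (supported I)"
  by (simp add: subspace_def supported_def)

lemma linear_single: "linear (single p)"
  by (rule linearI) (auto simp: single_def vec_eq_iff)

lemma span_quat_units: "span quat_units = UNIV"
proof -
  have "q = qRe q *\<^sub>R Quat 1 0 0 0 + qI q *\<^sub>R Quat 0 1 0 0 + qJ q *\<^sub>R Quat 0 0 1 0
      + qK q *\<^sub>R Quat 0 0 0 1" for q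
    by (simp add: quat_eq_iff plus_quat_def scaleR_quat_def)
  moreover have "qRe q *\<^sub>R Quat 1 0 0 0 + qI q *\<^sub>R Quat 0 1 0 0 + qJ q *\<^sub>R Quat 0 0 1 0
      + qK q *\<^sub>R Quat 0 0 0 1 \<in> span quat_units" for q
    by (intro span_add span_scale span_base) (auto simp: quat_units_def)
  ultimately show ?thesis
    by (metis UNIV_eq_I)
qed

lemma quat_units_combination_eq_0:
  assumes "(\<Sum>u\<in>quat_units. c u *\<^sub>R u) = 0" "u \<in> quat_units"
  shows "c u = 0"
proof -
  have "c (Quat 1 0 0 0) = 0 \<and> c (Quat 0 1 0 0) = 0 \<and> c (Quat 0 0 1 0) = 0 \<and> c (Quat 0 0 0 1) = 0"
    using assms(1) by (simp add: quat_units_def plus_quat_def scaleR_quat_def zero_quat_def)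
  then show ?thesis
    using assms(2) by (auto simp del: quat.inject simp: quat_units_def)
qed

text \<open>A real basis is given by placing each of the four quaternion units at each position of
  \<open>I\<close>.\<close>

lemma dim_supported: "dim (supported I) = 4 * card I"
proof -
  define b where "b = (\<lambda>(p, u). single p u :: 'a qmat)"
  define B where "B = b ` (I \<times> quat_units)"
  have fin: "finite quat_units"
    by (simp add: quat_units_def)
  have inj: "inj_on b (I \<times> quat_units)"
  proof (rule inj_onI; clarify)
    fix i j k l u v
    assume "u \<in> quat_units" "v \<in> quat_units" "b ((i, j), u) = b ((k, l), v)"
    then have "single (i, j) u $ i $ j = single (k, l) v $ i $ j" "u \<noteq> 0"
      by (auto simp: b_def quat_units_def zero_quat_def)
    then show "(i, j) = (k, l) \<and> u = v"
      by (auto simp: single_def split: if_splits)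
  qed
  have "independent B"
  proof (rule independent_if_scalars_zero)
    show "finite B"
      using fin by (simp add: B_def)
    fix f x assume sum: "(\<Sum>x\<in>B. f x *\<^sub>R x) = 0" and "x \<in> B"
    then obtain i j u where x: "x = single (i, j) u" "(i, j) \<in> I" "u \<in> quat_units"
      by (auto simp: B_def b_def)
    \<comment> \<open>Reading off entry \<open>(i, j)\<close> isolates the four coefficients
      belonging to that position.\<close>
    have "0 = (\<Sum>x\<in>B. f x *\<^sub>R x) $ i $ j"
      by (simp add: sum)
    also have "\<dots> = (\<Sum>(p, u)\<in>I \<times> quat_units. f (single p u) *\<^sub>R single p u $ i $ j)"
      unfolding B_def sum.reindex[OF inj] by (simp add: case_prod_beta b_def)
    also have "\<dots> = (\<Sum>p\<in>I. if p = (i, j) then \<Sum>u\<in>quat_units. f (single (i, j) u) *\<^sub>R u else 0)"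
      unfolding sum.cartesian_product[symmetric]
      by (intro sum.cong) (auto simp: single_def)
    also have "\<dots> = (\<Sum>u\<in>quat_units. f (single (i, j) u) *\<^sub>R u)"
      using x by simp
    finally show "f x = 0"
      using quat_units_combination_eq_0[where c = "\<lambda>u. f (single (i, j) u)"] x by simp
  qed
  moreover have "span B = supported I"
  proof
    show "span B \<subseteq> supported I"
      by (rule span_minimal[OF _ subspace_supported])
        (auto simp: B_def b_def supported_def single_def)
    show "supported I \<subseteq> span B"
    proof
      fix M assume M: "M \<in> supported I"
      have "single p q \<in> span B" if "p \<in> I" for p q
      proof -
        have "single p q \<in> single p ` span quat_units"
          by (simp add: span_quat_units)
        also have "\<dots> = span (single p ` quat_units)"
          by (simp add: linear_span_image linear_single)
        also have "\<dots> \<subseteq> span B"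
          using that by (intro span_mono) (auto simp: B_def b_def)
        finally show ?thesis .
      qed
      then have "(\<Sum>p\<in>I. single p (M $ fst p $ snd p)) \<in> span B"
        by (intro span_sum)
      moreover have "(\<Sum>p\<in>I. single p (M $ fst p $ snd p)) = M"
      proof -
        have "(\<Sum>p\<in>I. single p (M $ fst p $ snd p)) $ i $ j
            = (\<Sum>p\<in>I. if p = (i, j) then M $ i $ j else 0)" for i j
          by (auto simp: single_def intro!: sum.cong)
        then show ?thesis
          using M by (simp add: vec_eq_iff supported_def)
      qed
      ultimately show "M \<in> span B"
        by simp
    qed
  qed
  then have "span B = span (supported I)"
    by (metis span_span)
  ultimately have "dim (supported I) = card B"
    by (intro dim_eq_card) auto
  also have "\<dots> = card I * card quat_units"
    by (simp add: B_def card_image[OF inj] card_cartesian_product)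
  finally show ?thesis
    by (simp add: quat_units_def)
qed

lemma supported_subset_iff: "supported I \<subseteq> supported J \<longleftrightarrow> I \<subseteq> J"
proof
  assume *: "supported I \<subseteq> supported J"
  show "I \<subseteq> J"
  proof
    fix p assume "p \<in> I"
    then have "single p 1 \<in> supported I"
      by (auto simp: supported_def single_def)
    then have "single p 1 \<in> supported J"
      using * by blast
    moreover have "single p 1 $ fst p $ snd p \<noteq> 0"
      by (simp add: single_def)
    ultimately show "p \<in> J"
      unfolding supported_def by (metis (mono_tags, lifting) mem_Collect_eq prod.collapse)
  qed
qed (auto simp: supported_def)

lemma supported_Int: "supported I \<inter> supported J = supported (I \<inter> J)"
  by (auto simp: supported_def)

text \<open>This transports dimensions along a conjugation. It is stated for
  \<open>real_vector\<close> because \<open>quat\<close> carries no norm here.\<close>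

lemma dim_injective_image:
  fixes f :: "'a::real_vector \<Rightarrow> 'b::real_vector"
  assumes "linear f" "inj f"
  shows "dim (f ` V) = dim V"
proof -
  obtain B where B: "B \<subseteq> V" "independent B" "V \<subseteq> span B" "card B = dim V"
    using real_vector.basis_exists by blast
  then have "span B = span V"
    by (metis span_eq span_superset subset_trans)
  then have "span (f ` B) = span (f ` V)"
    by (simp add: linear_span_image assms)
  moreover have "independent (f ` B)"
    using B assms by (intro linear_independent_injective_image) (auto intro: inj_on_subset)
  ultimately have "dim (f ` V) = card (f ` B)"
    by (rule dim_eq_card)
  then show ?thesis
    using B assms by (simp add: card_image inj_on_subset)
qed

section \<open>Permuted triangular patterns\<close>

text \<open>These are the positions left free for a matrix that preserves the flag adjoining the
  axes \<open>\<sigma> j\<close> in increasing order of \<open>j\<close>.\<close>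

definition upper_pattern :: "('n::{finite,linorder} \<Rightarrow> 'n) \<Rightarrow> ('n \<times> 'n) set" where
  "upper_pattern \<sigma> = (\<lambda>(i, j). (\<sigma> i, \<sigma> j)) ` {(i, j). i \<le> j}"

lemma mem_upper_pattern_iff:
  assumes "bij \<sigma>"
  shows "(\<sigma> i, \<sigma> j) \<in> upper_pattern \<sigma> \<longleftrightarrow> i \<le> j"
  using bij_is_inj[OF assms] by (auto simp: upper_pattern_def inj_eq)

lemma supported_upper_pattern_iff:
  assumes "bij \<sigma>"
  shows "M \<in> supported (upper_pattern \<sigma>) \<longleftrightarrow> upper_triangular (\<chi> i j. M $ \<sigma> i $ \<sigma> j)"
proof -
  have "M \<in> supported (upper_pattern \<sigma>) \<longleftrightarrow>
      (\<forall>i j. (\<sigma> i, \<sigma> j) \<notin> upper_pattern \<sigma> \<longrightarrow> M $ \<sigma> i $ \<sigma> j = 0)"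
    unfolding supported_def using bij_is_surj[OF assms] by (auto simp: surj_def) metis
  then show ?thesis
    by (simp add: mem_upper_pattern_iff[OF assms] upper_triangular_def not_le)
qed

text \<open>The pairs with \<open>i \<le> j\<close> and their mirror images cover the square and
  meet in the diagonal; doubling the count avoids a division.\<close>

lemma card_upper_pattern:
  fixes \<sigma> :: "'n::{finite,linorder} \<Rightarrow> 'n"
  assumes "bij \<sigma>"
  shows "2 * card (upper_pattern \<sigma>) = CARD('n) * (CARD('n) + 1)"
proof -
  let ?L = "{(i :: 'n, j). i \<le> j}"
  let ?G = "{(i :: 'n, j). j \<le> i}"
  have "inj_on (\<lambda>(i, j). (\<sigma> i, \<sigma> j)) ?L"
    using bij_is_inj[OF assms] by (auto simp: inj_on_def)
  then have "card (upper_pattern \<sigma>) = card ?L"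
    by (simp add: upper_pattern_def card_image)
  moreover have "card ?G = card ?L"
    by (rule bij_betw_same_card[of prod.swap]) (rule bij_betwI[of _ _ _ prod.swap]; auto)
  moreover have "card ?L + card ?G = card (?L \<union> ?G) + card (?L \<inter> ?G)"
    by (intro card_Un_Int) auto
  moreover have "?L \<union> ?G = UNIV"
    by auto
  moreover have "?L \<inter> ?G = (\<lambda>i. (i, i)) ` UNIV"
    by auto
  moreover have "card ((\<lambda>i :: 'n. (i, i)) ` UNIV) = CARD('n)"
    by (intro card_image injI) auto
  ultimately show ?thesis
    by (simp add: card_cartesian_product flip: UNIV_Times_UNIV)
qed

text \<open>Column \<open>\<sigma> j\<close> of the pattern has as many entries as
  \<open>{..j}\<close> has elements, so column sizes recover the place of each axis in the
  flag.\<close>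

lemma upper_pattern_inject:
  fixes \<sigma> \<tau> :: "'n::{finite,linorder} \<Rightarrow> 'n"
  assumes "bij \<sigma>" "bij \<tau>" "upper_pattern \<sigma> = upper_pattern \<tau>"
  shows "\<sigma> = \<tau>"
proof
  have column: "card {a. (a, \<rho> j) \<in> upper_pattern \<rho>} = card {..j}" if "bij \<rho>" for \<rho> :: "'n \<Rightarrow> 'n" and j
  proof -
    have "{a. (a, \<rho> j) \<in> upper_pattern \<rho>} = \<rho> ` {..j}"
      using bij_is_inj[OF that] by (auto simp: upper_pattern_def inj_eq)
    then show ?thesis
      using bij_is_inj[OF that] by (simp add: card_image inj_on_subset)
  qed
  fix j
  obtain k where k: "\<tau> k = \<sigma> j"
    using bij_is_surj[OF assms(2)] by (metis surjD)
  have "card {..j} = card {..k}"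
    using column[OF assms(1), of j] column[OF assms(2), of k] assms(3) k by simp
  moreover have "card {..i} < card {..l}" if "i < l" for i l :: 'n
    using that by (intro psubset_card_mono) auto
  ultimately have "j = k"
    by (metis less_irrefl linorder_neqE)
  then show "\<sigma> j = \<tau> j"
    using k by simp
qed

lemma card_bijections: "card {\<sigma> :: 'n::finite \<Rightarrow> 'n. bij \<sigma>} = fact CARD('n)"
proof -
  have "{\<sigma> :: 'n \<Rightarrow> 'n. bij \<sigma>} = {\<sigma>. \<sigma> permutes UNIV}"
    by (auto simp: permutes_univ bij_iff)
  then show ?thesis
    using card_permutations[of "UNIV :: 'n set"] by simp
qed

section \<open>The fibre\<close>

text \<open>Distinct eigenvalues in the closed upper half plane are used twice: they make the
  Sylvester equations solvable, and they make the resulting diagonal entries pairwise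
  non-similar.\<close>

lemma generic_diagonalizable:
  fixes A :: "'n::{finite,linorder} qmat"
  assumes "generic A"
  obtains S X :: "'n qmat" and d where "S ** X = mat 1" "X ** S = mat 1" "S ** A = diagonal d ** S"
    and "pairwise_nonsimilar d"
proof -
  obtain ev and P :: "'n qmat" where "inj ev" and P: "invertible P"
    and T: "upper_triangular (P ** A ** matrix_inv P)"
    and ev: "\<And>i. (P ** A ** matrix_inv P) $ i $ i = quat_of_complex (ev i)" "\<And>i. 0 \<le> Im (ev i)"
    using assms unfolding generic_def eigenvalue_seq_def by blast
  define T where "T = P ** A ** matrix_inv P"
  define d where "d i = quat_of_complex (ev i)" for i
  have diag: "T $ i $ i = d i" for i
    by (simp add: T_def d_def ev)
  have "\<exists>r. T $ i $ i * r - r * T $ j $ j = c" if "i \<noteq> j" for i j c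
    unfolding diag d_def using that \<open>inj ev\<close> ev by (intro sylvester_solvable) (auto simp: inj_eq)
  then obtain Q where Q: "unitriangular Q" "T ** Q = Q ** diagonal d"
    using triangular_diagonalizable[of T] T unfolding T_def[symmetric] diag by metis
  obtain R where R: "Q ** R = mat 1" "R ** Q = mat 1"
    using unitriangular_inverse[OF Q(1)] .
  note PP = invertible_matrix_inv[OF P]
  show thesis
  proof (rule that[of "R ** P" "matrix_inv P ** Q" d])
    have "R ** P ** (matrix_inv P ** Q) = R ** (P ** matrix_inv P) ** Q"
      by (simp only: matrix_mul_assoc)
    then show "R ** P ** (matrix_inv P ** Q) = mat 1"
      by (simp add: PP R)
    have "matrix_inv P ** Q ** (R ** P) = matrix_inv P ** (Q ** R) ** P"
      by (simp only: matrix_mul_assoc)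
    then show "matrix_inv P ** Q ** (R ** P) = mat 1"
      by (simp add: PP R)
    \<comment> \<open>Inserting the identity on the right exposes the product \<open>T ** Q\<close>,
      which becomes \<open>Q ** diagonal d\<close>.\<close>
    have "R ** P ** A = R ** P ** A ** (matrix_inv P ** (Q ** R) ** P)"
      by (simp add: PP R)
    also have "\<dots> = R ** (T ** Q) ** R ** P"
      by (simp only: T_def matrix_mul_assoc)
    also have "\<dots> = (R ** Q) ** diagonal d ** (R ** P)"
      by (simp only: Q matrix_mul_assoc)
    finally show "R ** P ** A = diagonal d ** (R ** P)"
      by (simp add: R)
    have "y = 0" if "i \<noteq> k" "d i * y = y * d k" for i k y
      using complex_quat_not_similar[of "ev i" "ev k"] that \<open>inj ev\<close> ev by (simp add: d_def inj_eq)
    then show "pairwise_nonsimilar d"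
      by (auto simp: pairwise_nonsimilar_def)
  qed
qed

text \<open>In the eigenbasis of \<open>A\<close>, a triangularizing \<open>P\<close> yields the
  flag spanned by the columns of \<open>S ** matrix_inv P\<close>, stable under both matrices.
  Conversely, reordering the eigenbasis by \<open>\<sigma>\<close> triangularizes \<open>B\<close>
  and keeps \<open>A\<close> diagonal.\<close>

lemma fibre_diagonalized_iff:
  fixes A B S X :: "'n::{finite,linorder} qmat"
  assumes SX: "S ** X = mat 1" and XS: "X ** S = mat 1" and SA: "S ** A = diagonal d ** S"
    and nonsim: "pairwise_nonsimilar d"
  shows "(A, B) \<in> fibre A \<longleftrightarrow> (\<exists>\<sigma>. bij \<sigma> \<and> S ** B ** X \<in> supported (upper_pattern \<sigma>))"
proof
  assume "(A, B) \<in> fibre A"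
  then obtain P :: "'n qmat" where P: "invertible P"
    "upper_triangular (P ** A ** matrix_inv P)" "upper_triangular (P ** B ** matrix_inv P)"
    by (auto simp: fibre_def triangularizable_pairs_def)
  define R where "R = matrix_inv P"
  have R: "P ** R = mat 1" "R ** P = mat 1"
    using invertible_matrix_inv[OF P(1)] by (simp_all add: R_def)
  have "P ** X ** (S ** R) = P ** (X ** S) ** R"
    by (simp only: matrix_mul_assoc)
  then have YX: "P ** X ** (S ** R) = mat 1"
    by (simp add: XS R)
  have "S ** R ** (P ** A ** R) = S ** (R ** P) ** A ** R"
    by (simp only: matrix_mul_assoc)
  then have DX: "diagonal d ** (S ** R) = S ** R ** (P ** A ** R)"
    by (simp add: R SA matrix_mul_assoc)
  obtain \<sigma> :: "'n \<Rightarrow> 'n" where \<sigma>: "bij \<sigma>"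
    "\<And>B M i j. upper_triangular M \<Longrightarrow> B ** (S ** R) = S ** R ** M \<Longrightarrow> j < i \<Longrightarrow> B $ \<sigma> i $ \<sigma> j = 0"
    using diagonal_flag_permutation[OF nonsim YX _ DX] P(2) unfolding R_def by blast
  have "S ** B ** X ** (S ** R) = S ** B ** (X ** S) ** R"
    by (simp only: matrix_mul_assoc)
  also have "\<dots> = S ** (R ** P) ** B ** R"
    by (simp add: XS R)
  also have "\<dots> = S ** R ** (P ** B ** R)"
    by (simp only: matrix_mul_assoc)
  finally have "upper_triangular (\<chi> i j. (S ** B ** X) $ \<sigma> i $ \<sigma> j)"
    using \<sigma>(2)[of "P ** B ** R"] P(3) by (simp add: upper_triangular_def R_def)
  then show "\<exists>\<sigma>. bij \<sigma> \<and> S ** B ** X \<in> supported (upper_pattern \<sigma>)"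
    using supported_upper_pattern_iff \<sigma>(1) by blast
next
  assume "\<exists>\<sigma>. bij \<sigma> \<and> S ** B ** X \<in> supported (upper_pattern \<sigma>)"
  then obtain \<sigma> where \<sigma>: "bij \<sigma>" "S ** B ** X \<in> supported (upper_pattern \<sigma>)"
    by blast
  define P :: "'n qmat" where "P = (\<chi> i j. S $ \<sigma> i $ j)"
  define R :: "'n qmat" where "R = (\<chi> i j. X $ i $ \<sigma> j)"
  have PMR: "P ** M ** R = (\<chi> i j. (S ** M ** X) $ \<sigma> i $ \<sigma> j)" for M
    by (simp add: P_def R_def matrix_matrix_mult_def)
  have "P ** R = (\<chi> i j. (S ** X) $ \<sigma> i $ \<sigma> j)"
    using PMR[of "mat 1"] by simp
  also have "\<dots> = mat 1"
    using bij_is_inj[OF \<sigma>(1)] by (simp add: SX vec_eq_iff mat_def inj_eq)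
  finally have PR: "P ** R = mat 1" .
  have "(R ** P) $ i $ j = (X ** S) $ i $ j" for i j
    unfolding R_def P_def matrix_matrix_mult_def
    using sum.reindex_bij_betw[of \<sigma> UNIV UNIV "\<lambda>k. X $ i $ k * S $ k $ j"] \<sigma>(1) by simp
  then have RP: "R ** P = mat 1"
    by (simp add: vec_eq_iff XS)
  have "S ** A ** X = diagonal d"
    by (simp add: SA SX flip: matrix_mul_assoc)
  then have "upper_triangular (P ** A ** R)"
    using bij_is_inj[OF \<sigma>(1)] by (auto simp: PMR upper_triangular_def diagonal_def inj_eq)
  moreover have "upper_triangular (P ** B ** R)"
    using \<sigma> by (simp add: PMR supported_upper_pattern_iff)
  moreover have "invertible P" "matrix_inv P = R"
    using PR RP matrix_inv_unique by (auto simp: invertible_def)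
  ultimately show "(A, B) \<in> fibre A"
    by (auto simp: fibre_def triangularizable_pairs_def)
qed

theorem proposition6p5:
  fixes A :: "'n::{finite,linorder} qmat"
  assumes "generic A"
  shows "\<exists>\<V> :: 'n qmat set set.
    card \<V> = fact CARD('n) \<and>
    fibre A = (\<Union>V\<in>\<V>. {A} \<times> V) \<and>
    (\<forall>V\<in>\<V>. subspace V \<and> dim V = 2 * CARD('n) * (CARD('n) + 1)) \<and>
    (\<forall>V\<in>\<V>. \<forall>W\<in>\<V>. subspace (V \<inter> W) \<and> 4 * CARD('n) \<le> dim (V \<inter> W))"
proof -
  obtain S X :: "'n qmat" and d where SX: "S ** X = mat 1" and XS: "X ** S = mat 1" and SA: "S ** A = diagonal d ** S"
    and nonsim: "pairwise_nonsimilar d"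
    by (rule generic_diagonalizable[OF assms])
  \<comment> \<open>\<open>\<psi>\<close> returns from the eigenbasis of \<open>A\<close> to the
    original coordinates; its inverse sends \<open>B\<close> to \<open>S ** B ** X\<close>.\<close>
  define \<psi> where "\<psi> M = X ** M ** S" for M
  have inv1: "S ** \<psi> M ** X = M" for M
  proof -
    have "S ** \<psi> M ** X = (S ** X) ** M ** (S ** X)"
      by (simp only: \<psi>_def matrix_mul_assoc)
    then show ?thesis
      by (simp add: SX)
  qed
  have inv2: "\<psi> (S ** B ** X) = B" for B
  proof -
    have "\<psi> (S ** B ** X) = (X ** S) ** B ** (X ** S)"
      by (simp only: \<psi>_def matrix_mul_assoc)
    then show ?thesis
      by (simp add: XS)
  qed
  have "linear \<psi>"
    by (rule linearI)
      (simp_all add: \<psi>_def vec_eq_iff matrix_matrix_mult_def distrib_left distrib_right sum.distrib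
        scaleR_sum_right[symmetric] sum_distrib_right)
  have "inj \<psi>"
    by (metis injI inv1)
  define E where "E I = \<psi> ` supported I" for I
  have mem_E: "B \<in> E I \<longleftrightarrow> S ** B ** X \<in> supported I" for B I
    unfolding E_def using inv1 inv2 by (metis imageE image_eqI)
  have sub_E: "subspace (E I)" for I
    unfolding E_def using \<open>linear \<psi>\<close> subspace_supported by (rule linear_subspace_image)
  have dim_E: "dim (E I) = 4 * card I" for I
    unfolding E_def using dim_injective_image[OF \<open>linear \<psi>\<close> \<open>inj \<psi>\<close>] dim_supported by metis
  have E_Int: "E I \<inter> E J = E (I \<inter> J)" for I J
    by (auto simp: mem_E simp flip: supported_Int)
  have E_inject: "I = J" if "E I = E J" for I J
    using that \<open>inj \<psi>\<close> supported_subset_iff unfolding E_def by (metis inj_image_eq_iff subset_antisym subset_refl)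
  define \<V> where "\<V> = (\<lambda>\<sigma>. E (upper_pattern \<sigma>)) ` {\<sigma>. bij \<sigma>}"
  \<comment> \<open>Different permutations have different patterns, and different patterns support
    different spaces, so no two of the spaces coincide.\<close>
  have "card \<V> = fact CARD('n)"
    unfolding \<V>_def card_bijections[symmetric]
    by (intro card_image inj_onI) (auto dest: E_inject intro: upper_pattern_inject)
  moreover have "fibre A = (\<Union>V\<in>\<V>. {A} \<times> V)"
  proof -
    have "p \<in> fibre A \<longleftrightarrow> fst p = A \<and> (\<exists>V\<in>\<V>. snd p \<in> V)" for p
      using fibre_diagonalized_iff[OF SX XS SA nonsim, of "snd p"]
      by (cases p) (auto simp: \<V>_def mem_E fibre_def)
    then show ?thesis
      by force
  qed
  moreover have "subspace V \<and> dim V = 2 * CARD('n) * (CARD('n) + 1)" if V: "V \<in> \<V>" for V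
  proof -
    obtain \<sigma> :: "'n \<Rightarrow> 'n" where "bij \<sigma>" "V = E (upper_pattern \<sigma>)"
      using V by (auto simp: \<V>_def)
    then show ?thesis
      using card_upper_pattern[of \<sigma>] by (simp add: sub_E dim_E)
  qed
  moreover have "subspace (V \<inter> W) \<and> 4 * CARD('n) \<le> dim (V \<inter> W)" if VW: "V \<in> \<V>" "W \<in> \<V>" for V W
  proof -
    obtain \<sigma> \<tau> where *: "bij \<sigma>" "bij \<tau>" "V = E (upper_pattern \<sigma>)" "W = E (upper_pattern \<tau>)"
      using VW by (auto simp: \<V>_def)
    have "(i, i) \<in> upper_pattern \<rho>" if "bij \<rho>" for i and \<rho> :: "'n \<Rightarrow> 'n"
      using mem_upper_pattern_iff[OF that] bij_is_surj[OF that] by (metis order_refl surjD)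
    \<comment> \<open>The common diagonal alone contributes four real dimensions for each
      index.\<close>
    then have "(\<lambda>i. (i, i)) ` UNIV \<subseteq> upper_pattern \<sigma> \<inter> upper_pattern \<tau>"
      using * by auto
    then have "card ((\<lambda>i :: 'n. (i, i)) ` UNIV) \<le> card (upper_pattern \<sigma> \<inter> upper_pattern \<tau>)"
      by (intro card_mono) auto
    moreover have "card ((\<lambda>i :: 'n. (i, i)) ` UNIV) = CARD('n)"
      by (intro card_image injI) auto
    ultimately show ?thesis
      by (simp add: * E_Int sub_E dim_E)
  qed
  ultimately show ?thesis
    by blast
qed

end
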